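(* Let $n$ and $m$ be nonnegative integers. Then, for every complex number $x$ (equivalently, as an identity of polynomials in $x$), $$\frac{(1-x)^{(n+1)}}{(n+1)!}\sum_{k=0}^m\frac{n+1}{n+k+1}\,\frac{x^{(k)}}{k!}+\frac{x^{(m+1)}}{(m+1)!}\sum_{k=0}^n\frac{m+1}{m+k+1}\,\frac{(1-x)^{(k)}}{k!}=1.$$
   Context: For a complex number $z$ and a nonnegative integer $n$, $z^{(n)}=\prod_{j=0}^{n-1}(z+j)$ denotes the rising factorial, with $z^{(0)}=1$ (empty product). *)

theory Defs
  imports Complex_Main
begin

end

theory Submission
  imports Defs
begin

text \<open>
  Put \<open>y = 1 - x\<close>, and write the two summands on the left as
  \<open>A n m = pochhammer y (n+1) / n! * (\<Sum>k\<le>m. pochhammer x k / (k! (n+k+1)))\<close> and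
  \<open>B n m = pochhammer x (m+1) / m! * (\<Sum>k\<le>n. pochhammer y k / (k! (m+k+1)))\<close>.
  The idea is that \<open>A n m + B n m\<close> is independent of \<open>m\<close>. Passing from \<open>m\<close> to \<open>m+1\<close>
  adds a single term to the sum in \<open>A\<close>, so that \<open>A\<close> grows by
  \<open>pochhammer y (n+1) * pochhammer x (m+1) / (n! (m+1)! (n+m+2))\<close>.
  In \<open>B\<close> every term changes, but after extracting the common factor
  \<open>pochhammer x (m+1) / (m+1)!\<close> the changes telescope in \<open>k\<close>
  (\<open>pochhammer_weight_telescope\<close>), and \<open>B\<close> drops by exactly the same amount.
  For \<open>m = 0\<close> the identity is \<open>pochhammer_sum_base\<close>, which is again a telescoping sum.
  Only division by positive integers occurs, so any field of characteristic zero will do.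
\<close>

text \<open>
  Since the two linear factors satisfy \<open>(x+m+1) + (1-x+k) = m+k+2\<close>, the \<open>k\<close>-th weight
  \<open>(m+1)/(m+k+1) - (x+m+1)/(m+k+2)\<close> equals \<open>(1-x+k)/(m+k+2) - k/(m+k+1)\<close>. This is the
  increment of the right-hand side, divided by \<open>pochhammer (1-x) k / k!\<close>.
\<close>

lemma pochhammer_weight_telescope:
  fixes x :: "'a::field_char_0"
  shows "(\<Sum>k=0..n. pochhammer (1 - x) k / fact k *
            (of_nat (m + 1) / of_nat (m + k + 1) - (x + of_nat (m + 1)) / of_nat (m + k + 2)))
         = pochhammer (1 - x) (n + 1) / (fact n * of_nat (n + m + 2))"
proof (induction n)
  case 0
  have "of_nat (m + 1) \<noteq> (0::'a)" "of_nat (m + 2) \<noteq> (0::'a)"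
    by (simp_all only: of_nat_eq_0_iff)
  then show ?case
    by (simp add: field_simps)
next
  case (Suc n)
  define p where "p = pochhammer (1 - x) (n + 1)"
  define a where "a = (of_nat (n + m + 2) :: 'a)"
  define b where "b = (of_nat (n + 1) :: 'a)"
  define f where "f = (fact n :: 'a)"
  have nz: "a \<noteq> 0" "a + 1 \<noteq> 0" "b \<noteq> 0" "f \<noteq> 0"
  proof -
    have "a + 1 = of_nat (n + m + 3)"
      by (simp add: a_def)
    then show "a + 1 \<noteq> 0"
      by (simp only: of_nat_eq_0_iff)
    show "a \<noteq> 0" "b \<noteq> 0"
      unfolding a_def b_def by (simp_all only: of_nat_eq_0_iff)
  qed (simp add: f_def)
  have eqs: "of_nat (m + 1) = a - b" "of_nat (m + Suc n + 1) = a" "of_nat (m + Suc n + 2) = a + 1"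
      "of_nat (Suc n + m + 2) = a + 1"
    by (simp_all add: a_def b_def)
  have fs: "fact (Suc n) = b * f"
    by (simp add: b_def f_def)
  have ps: "pochhammer (1 - x) (Suc n + 1) = p * (1 - x + b)"
    by (simp add: p_def b_def pochhammer_Suc)
  have "p / (f * a) + p / (b * f) * ((a - b) / a - (x + (a - b)) / (a + 1))
        = p * (1 - x + b) / (b * f * (a + 1))"
    using nz by (simp add: divide_simps) (simp add: algebra_simps)
  then show ?case
    using Suc.IH unfolding sum.atLeast0_atMost_Suc fs ps eqs
    by (simp add: p_def a_def f_def)
qed

text \<open>
  The first summand is what \<open>x\<close> times the sum still lacks to reach 1:
  \<open>pochhammer (1-x) (n+2) / (n+2)!\<close> is the preceding remainder times
  \<open>(n+2-x)/(n+2) = 1 - x/(n+2)\<close>, and it loses \<open>x\<close> times the new term of the sum.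
\<close>

lemma pochhammer_sum_base:
  fixes x :: "'a::field_char_0"
  shows "pochhammer (1 - x) (n + 1) / fact (n + 1)
         + x * (\<Sum>k=0..n. pochhammer (1 - x) k / fact (k + 1)) = 1"
proof (induction n)
  case 0
  show ?case by simp
next
  case (Suc n)
  define p where "p = pochhammer (1 - x) (n + 1)"
  define b where "b = (of_nat (n + 2) :: 'a)"
  define f where "f = (fact (n + 1) :: 'a)"
  have nz: "b \<noteq> 0" "f \<noteq> 0"
    unfolding b_def f_def by (simp_all only: of_nat_eq_0_iff fact_nonzero not_False_eq_True)
  have fs: "fact (Suc n + 1) = b * f"
    by (simp add: b_def f_def algebra_simps)
  have ps: "pochhammer (1 - x) (Suc n + 1) = p * (b - x)"
    by (simp add: p_def b_def pochhammer_Suc algebra_simps)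
  have "p * (b - x) / (b * f) + x * (p / (b * f)) = p / f"
    using nz by (simp add: field_simps)
  then show ?case
    using Suc.IH unfolding sum.atLeast0_atMost_Suc fs ps
    by (simp add: p_def f_def algebra_simps)
qed

lemma pochhammer_reflection_identity:
  fixes x :: "'a::field_char_0"
  shows "pochhammer (1 - x) (n + 1) / fact (n + 1) *
           (\<Sum>k=0..m. of_nat (n + 1) / of_nat (n + k + 1) * (pochhammer x k / fact k))
       + pochhammer x (m + 1) / fact (m + 1) *
           (\<Sum>k=0..n. of_nat (m + 1) / of_nat (m + k + 1) * (pochhammer (1 - x) k / fact k))
       = 1"
proof (induction m)
  case 0
  have "of_nat (n + 1) / of_nat (n + 0 + 1) = (1::'a)"
    by (simp only: add_0_right divide_self_if of_nat_eq_0_iff) simp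
  moreover have "of_nat (0 + 1) / of_nat (0 + k + 1) * (pochhammer (1 - x) k / fact k)
      = pochhammer (1 - x) k / fact (k + 1)" for k
    by simp
  ultimately show ?case
    using pochhammer_sum_base[of x n] by simp
next
  case (Suc m)
  define p where "p = pochhammer (1 - x) (n + 1)"
  define q where "q = pochhammer x (m + 1)"
  define c where "c = (of_nat (n + m + 2) :: 'a)"
  define S where "S j = (\<Sum>k=0..n. of_nat (j + 1) / of_nat (j + k + 1) *
    (pochhammer (1 - x) k / fact k))" for j
  define T where "T = (\<Sum>k=0..m. of_nat (n + 1) / of_nat (n + k + 1) *
    (pochhammer x k / fact k))"
  have m2: "of_nat (m + 2) \<noteq> (0::'a)"
    by (simp only: of_nat_eq_0_iff)
  have n1: "of_nat (n + 1) \<noteq> (0::'a)"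
    by (simp only: of_nat_eq_0_iff)
  have A_step: "p / fact (n + 1) * (of_nat (n + 1) / c * (q / fact (m + 1)))
      = q / fact (m + 1) * (p / (fact n * c))"
    using n1 by (simp add: divide_simps)
  have B_coeff: "pochhammer x (m + 2) / fact (m + 2)
      = q / fact (m + 1) * ((x + of_nat (m + 1)) / of_nat (m + 2))"
  proof -
    have "pochhammer x (m + 2) = q * (x + of_nat (m + 1))"
      by (simp add: q_def pochhammer_Suc)
    moreover have "fact (m + 2) = fact (m + 1) * (of_nat (m + 2) :: 'a)"
      by (simp add: algebra_simps)
    ultimately show ?thesis by simp
  qed
  \<comment> \<open>Since \<open>q / (m+1)!\<close> is a common factor of both second summands (\<open>B_coeff\<close>), the drop
    of the second summand is governed by this difference, whose weights telescope.\<close>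
  have "S m - (x + of_nat (m + 1)) / of_nat (m + 2) * S (m + 1)
      = (\<Sum>k=0..n. pochhammer (1 - x) k / fact k *
          (of_nat (m + 1) / of_nat (m + k + 1) - (x + of_nat (m + 1)) / of_nat (m + k + 2)))"
    unfolding S_def sum_distrib_left sum_subtractf[symmetric]
  proof (rule sum.cong[OF refl])
    fix k
    have e: "m + 1 + 1 = m + 2" "m + 1 + k + 1 = m + k + 2" by simp_all
    have cancel: "u / v * (v / w * z) = z * (u / w)" if "v \<noteq> 0" for u v w z :: 'a
      using that by simp
    show "of_nat (m + 1) / of_nat (m + k + 1) * (pochhammer (1 - x) k / fact k)
        - (x + of_nat (m + 1)) / of_nat (m + 2) *
          (of_nat (m + 1 + 1) / of_nat (m + 1 + k + 1) * (pochhammer (1 - x) k / fact k))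
        = pochhammer (1 - x) k / fact k *
          (of_nat (m + 1) / of_nat (m + k + 1) - (x + of_nat (m + 1)) / of_nat (m + k + 2))"
      unfolding e cancel[OF m2] right_diff_distrib by (simp only: mult.commute)
  qed
  also have "\<dots> = p / (fact n * c)"
    unfolding p_def c_def by (rule pochhammer_weight_telescope)
  finally have B_step: "(x + of_nat (m + 1)) / of_nat (m + 2) * S (m + 1)
      = S m - p / (fact n * c)"
    by (simp add: algebra_simps)
  have IH: "p / fact (n + 1) * T + q / fact (m + 1) * S m = 1"
    using Suc.IH unfolding p_def q_def T_def S_def .
  have "p / fact (n + 1) * (T + of_nat (n + 1) / c * (q / fact (m + 1)))
      + pochhammer x (m + 2) / fact (m + 2) * S (m + 1)
      = p / fact (n + 1) * T + q / fact (m + 1) * (p / (fact n * c))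
      + q / fact (m + 1) * (S m - p / (fact n * c))"
    unfolding B_coeff distrib_left A_step mult.assoc B_step ..
  also have "\<dots> = 1"
    using IH by (simp only: right_diff_distrib) simp
  finally have fin: "p / fact (n + 1) * (T + of_nat (n + 1) / c * (q / fact (m + 1)))
      + pochhammer x (m + 2) / fact (m + 2) * S (m + 1) = 1" .
  have idx: "Suc m + 1 = m + 2" "n + Suc m + 1 = n + m + 2" "Suc m = m + 1"
    by simp_all
  show ?case
    unfolding sum.atLeast0_atMost_Suc
    using fin unfolding idx p_def q_def c_def S_def T_def
    by (simp only: add.assoc one_add_one)
qed

theorem theorem6p4:
  fixes n m :: nat and x :: complex
  shows "pochhammer (1 - x) (n + 1) / fact (n + 1) *
           (\<Sum>k=0..m. of_nat (n + 1) / of_nat (n + k + 1) * (pochhammer x k / fact k))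
       + pochhammer x (m + 1) / fact (m + 1) *
           (\<Sum>k=0..n. of_nat (m + 1) / of_nat (m + k + 1) * (pochhammer (1 - x) k / fact k))
       = 1"
  by (rule pochhammer_reflection_identity)

end
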